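(* Let $f\in\mathcal{C}(\Omega)$ and $\lambda>0$, and let the quadrature rule have exactness degree $2n$. Then: (a) $\langle f-\mathcal{H}_n^{\lambda}f,\mathcal{H}_n^{\lambda}f\rangle_N=0$; (b) $\langle \mathcal{H}_n^{\lambda}f,\mathcal{H}_n^{\lambda}f\rangle_N+\langle f-\mathcal{H}_n^{\lambda}f,f-\mathcal{H}_n^{\lambda}f\rangle_N=\langle f,f\rangle_N$; (c) $\langle \mathcal{H}_n^{\lambda}f,\mathcal{H}_n^{\lambda}f\rangle_N\le\langle f,f\rangle_N$.
   Context: $\Omega\subset\mathbb{R}^s$ is a compact smooth Riemannian manifold with smooth or empty boundary, equipped with a measure $\mathrm{d}\omega$ with $\int_\Omega \mathrm{d}\omega=V<\infty$. $\mathcal{C}(\Omega)$ is the space of continuous real functions on $\Omega$, and $\langle f,g\rangle=\int_\Omega fg\,\mathrm{d}\omega$. $\mathbb{P}_n(\Omega)$ is the space of polynomials of total degree at most $n$ restricted to $\Omega$, $d_n=\dim\mathbb{P}_n(\Omega)$, and $\{\Phi_\ell\}_{\ell=1}^{d_n}$ is a fixed orthonormal basis of $\mathbb{P}_n(\Omega)$ with respect to $\langle\cdot,\cdot\rangle$. Quadrature rule: nodes $\mathbf{x}_1,\dots,\mathbf{x}_N\in\Omega$ and weights $w_1,\dots,w_N>0$ such that $\int_\Omega p\,\mathrm{d}\omega=\sum_{j=1}^N w_jp(\mathbf{x}_j)$ for all $p\in\mathbb{P}_{2n}(\Omega)$ (exactness degree $2n$). The discrete (semi) inner product is $\langle f,g\rangle_N=\sum_{j=1}^N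 w_jf(\mathbf{x}_j)g(\mathbf{x}_j)$. The hard thresholding operator is $\eta_H(a,k)=a$ if $|a|>k$ and $\eta_H(a,k)=0$ if $|a|\le k$. The hard thresholding hyperinterpolation of $f$ is $\mathcal{H}_n^\lambda f=\sum_{\ell=1}^{d_n}\eta_H(\langle f,\Phi_\ell\rangle_N,\lambda)\Phi_\ell$, $\lambda>0$. *)

theory Defs
  imports "HOL-Analysis.Analysis" "HOL-Library.Function_Algebras"
begin

section \<open>Compact smooth submanifolds of Euclidean space\<close>

primrec higher_differentiable_on ::
  "nat \<Rightarrow> 'a::euclidean_space set \<Rightarrow> ('a \<Rightarrow> 'b::real_normed_vector) \<Rightarrow> bool" where
  "higher_differentiable_on 0 U f \<longleftrightarrow> continuous_on U f"
| "higher_differentiable_on (Suc k) U f \<longleftrightarrow>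
     (\<forall>x\<in>U. f differentiable (at x)) \<and>
     (\<forall>v. higher_differentiable_on k U (\<lambda>x. frechet_derivative f (at x) v))"

definition smooth_on :: "'a::euclidean_space set \<Rightarrow> ('a \<Rightarrow> 'b::real_normed_vector) \<Rightarrow> bool" where
  "smooth_on U f \<longleftrightarrow> (\<forall>k. higher_differentiable_on k U f)"

text \<open>
  Embedded smooth submanifolds of dimension \<open>m\<close>, with possibly empty boundary, given by slice
  charts: around each of its points, \<open>\<Omega>\<close> is straightened by a diffeomorphism of open subsets of the
  ambient space to an \<open>m\<close>-dimensional linear subspace \<open>S\<close>, or to a closed half-space of \<open>S\<close>.
  The Riemannian structure is the one induced by the ambient space, hence it is determined by
  the set \<open>\<Omega>\<close>.
\<close>

definition smooth_submanifold_with_boundary :: "nat \<Rightarrow> 'a::euclidean_space set \<Rightarrow> bool" where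
  "smooth_submanifold_with_boundary m \<Omega> \<longleftrightarrow>
     (\<forall>p\<in>\<Omega>. \<exists>U V (\<phi> :: 'a \<Rightarrow> 'a) (\<psi> :: 'a \<Rightarrow> 'a) S.
        open U \<and> p \<in> U \<and> open V \<and> homeomorphism U V \<phi> \<psi> \<and> smooth_on U \<phi> \<and> smooth_on V \<psi> \<and>
        subspace S \<and> dim S = m \<and>
        (\<phi> ` (U \<inter> \<Omega>) = V \<inter> S \<or>
         (\<exists>e\<in>S. e \<noteq> 0 \<and> \<phi> ` (U \<inter> \<Omega>) = V \<inter> {y \<in> S. 0 \<le> y \<bullet> e})))"


section \<open>Polynomial spaces\<close>

text \<open>
  The real vector space of all real functions; addition on functions is pointwise. It supplies
  \<open>real_fun.span\<close>, \<open>real_fun.independent\<close> and \<open>real_fun.dim\<close>.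
\<close>

global_interpretation real_fun: vector_space "\<lambda>(c::real) (f::'a \<Rightarrow> real) x. c * f x"
  by unfold_locales (auto simp: fun_eq_iff algebra_simps)

definition polynomials_degree_le :: "nat \<Rightarrow> (real^'s \<Rightarrow> real) set" where
  "polynomials_degree_le n =
     {p. \<exists>c :: ('s \<Rightarrow> nat) \<Rightarrow> real.
           p = (\<lambda>x. \<Sum>\<alpha> | (\<Sum>i\<in>UNIV. \<alpha> i) \<le> n. c \<alpha> * (\<Prod>i\<in>UNIV. (x $ i) ^ \<alpha> i))}"

text \<open>
  A function on \<open>\<Omega>\<close> is represented by its extension by zero, so that two polynomials that agree
  on \<open>\<Omega>\<close> give the same element and the dimension is that of the space of restrictions.
\<close>

definition poly_space :: "nat \<Rightarrow> (real^'s) set \<Rightarrow> (real^'s \<Rightarrow> real) set" where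
  "poly_space n \<Omega> = (\<lambda>p x. if x \<in> \<Omega> then p x else 0) ` polynomials_degree_le n"

definition poly_dim :: "nat \<Rightarrow> (real^'s) set \<Rightarrow> nat" where
  "poly_dim n \<Omega> = real_fun.dim (poly_space n \<Omega>)"

definition L2_inner :: "'a measure \<Rightarrow> ('a \<Rightarrow> real) \<Rightarrow> ('a \<Rightarrow> real) \<Rightarrow> real" where
  "L2_inner M f g = (LINT x|M. f x * g x)"

definition orthonormal_basis ::
  "(real^'s) measure \<Rightarrow> (real^'s) set \<Rightarrow> nat \<Rightarrow> (nat \<Rightarrow> real^'s \<Rightarrow> real) \<Rightarrow> bool" where
  "orthonormal_basis M \<Omega> n \<Phi> \<longleftrightarrow>
     inj_on \<Phi> {1..poly_dim n \<Omega>} \<and>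
     real_fun.independent (\<Phi> ` {1..poly_dim n \<Omega>}) \<and>
     real_fun.span (\<Phi> ` {1..poly_dim n \<Omega>}) = poly_space n \<Omega> \<and>
     (\<forall>k\<in>{1..poly_dim n \<Omega>}. \<forall>l\<in>{1..poly_dim n \<Omega>}.
        L2_inner M (\<Phi> k) (\<Phi> l) = (if k = l then 1 else 0))"


section \<open>Quadrature and hard thresholding hyperinterpolation\<close>

definition exact_quadrature ::
  "(real^'s) measure \<Rightarrow> (real^'s) set \<Rightarrow> nat \<Rightarrow> nat \<Rightarrow> (nat \<Rightarrow> real^'s) \<Rightarrow> (nat \<Rightarrow> real) \<Rightarrow> bool" where
  "exact_quadrature M \<Omega> deg N x w \<longleftrightarrow>
     (\<forall>j\<in>{1..N}. x j \<in> \<Omega> \<and> w j > 0) \<and>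
     (\<forall>p\<in>poly_space deg \<Omega>. (LINT y|M. p y) = (\<Sum>j=1..N. w j * p (x j)))"

definition discrete_inner ::
  "nat \<Rightarrow> (nat \<Rightarrow> 'a) \<Rightarrow> (nat \<Rightarrow> real) \<Rightarrow> ('a \<Rightarrow> real) \<Rightarrow> ('a \<Rightarrow> real) \<Rightarrow> real" where
  "discrete_inner N x w f g = (\<Sum>j=1..N. w j * f (x j) * g (x j))"

definition hard_threshold :: "real \<Rightarrow> real \<Rightarrow> real" where
  "hard_threshold a k = (if \<bar>a\<bar> > k then a else 0)"

definition hard_hyperinterpolation ::
  "(real^'s) set \<Rightarrow> nat \<Rightarrow> (nat \<Rightarrow> real^'s \<Rightarrow> real) \<Rightarrow> nat \<Rightarrow> (nat \<Rightarrow> real^'s) \<Rightarrow> (nat \<Rightarrow> real) \<Rightarrow>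
   real \<Rightarrow> (real^'s \<Rightarrow> real) \<Rightarrow> real^'s \<Rightarrow> real" where
  "hard_hyperinterpolation \<Omega> n \<Phi> N x w lam f =
     (\<lambda>y. \<Sum>l=1..poly_dim n \<Omega>. hard_threshold (discrete_inner N x w f (\<Phi> l)) lam * \<Phi> l y)"

end

theory Submission
  imports Defs
begin

text \<open>
  Products of two elements of \<open>\<P>\<^sub>n\<close> lie in \<open>\<P>\<^sub>2\<^sub>n\<close>, so exactness of degree \<open>2n\<close> makes the basis
  orthonormal for the discrete form as well. With \<open>a\<^sub>l\<close> the discrete coefficients of \<open>f\<close> and \<open>h\<^sub>l\<close>
  their thresholded values, \<open>\<langle>f, H\<rangle> = \<Sum> h\<^sub>l a\<^sub>l\<close> and \<open>\<langle>H, H\<rangle> = \<Sum> h\<^sub>l\<^sup>2\<close>, and these agree because a hard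
  threshold either keeps or kills a coefficient. Pythagoras and nonnegativity of the weights give the rest.
\<close>

text \<open>Every exponent is bounded by the total degree, so the multi-indices lie in a finite box.
  Finiteness is what allows sums over monomials to be regrouped below.\<close>

lemma finite_multi_indices: "finite {\<alpha> :: 's::finite \<Rightarrow> nat. (\<Sum>i\<in>UNIV. \<alpha> i) \<le> n}"
proof (rule finite_subset)
  show "{\<alpha> :: 's \<Rightarrow> nat. (\<Sum>i\<in>UNIV. \<alpha> i) \<le> n} \<subseteq> PiE UNIV (\<lambda>_. {..n})"
  proof (intro subsetI PiE_I)
    fix \<alpha> :: "'s \<Rightarrow> nat" and i
    assume "\<alpha> \<in> {\<alpha>. (\<Sum>i\<in>UNIV. \<alpha> i) \<le> n}"
    then show "\<alpha> i \<in> {..n}"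
      using member_le_sum[of i UNIV \<alpha>] by simp
  qed simp
qed (simp add: finite_PiE)

text \<open>Cauchy product: multiplying monomials adds their multi-indices, so the double sum is
  collected by the value of the index sum, whose total degree is at most
  \<open>m + n\<close>.\<close>

lemma polynomials_degree_le_mult:
  assumes "p \<in> polynomials_degree_le m" and "q \<in> polynomials_degree_le n"
  shows "(\<lambda>x. p x * q x) \<in> polynomials_degree_le (m + n)"
proof -
  define A where "A k = {\<alpha> :: 'a \<Rightarrow> nat. (\<Sum>i\<in>UNIV. \<alpha> i) \<le> k}" for k
  define mono where "mono \<alpha> x = (\<Prod>i\<in>UNIV. (x $ i) ^ \<alpha> i)" for \<alpha> and x :: "real^'a"
  define add :: "('a \<Rightarrow> nat) \<times> ('a \<Rightarrow> nat) \<Rightarrow> 'a \<Rightarrow> nat" where "add = (\<lambda>(\<alpha>, \<beta>) i. \<alpha> i + \<beta> i)"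
  have fin: "finite (A k)" for k
    unfolding A_def by (rule finite_multi_indices)
  obtain c d where p: "p = (\<lambda>x. \<Sum>\<alpha>\<in>A m. c \<alpha> * mono \<alpha> x)"
    and q: "q = (\<lambda>x. \<Sum>\<beta>\<in>A n. d \<beta> * mono \<beta> x)"
    using assms unfolding polynomials_degree_le_def A_def mono_def by blast
  \<comment> \<open>The convolution of \<open>c\<close> and \<open>d\<close>: all pairs of indices
    with the same sum \<gamma> contribute to the coefficient of one monomial.\<close>
  define e where "e \<gamma> = (\<Sum>z | z \<in> A m \<times> A n \<and> add z = \<gamma>. c (fst z) * d (snd z))" for \<gamma>
  have mono_add: "mono (add z) x = mono (fst z) x * mono (snd z) x" for z x
    by (simp add: mono_def add_def power_add prod.distrib split_beta)
  have add_in: "add ` (A m \<times> A n) \<subseteq> A (m + n)"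
    by (auto simp: A_def add_def sum.distrib intro: add_mono)
  have "p x * q x = (\<Sum>\<gamma>\<in>A (m + n). e \<gamma> * mono \<gamma> x)" for x
  proof -
    have "p x * q x = (\<Sum>z\<in>A m \<times> A n. c (fst z) * d (snd z) * mono (add z) x)"
      by (simp add: p q sum_product sum.cartesian_product mono_add split_beta mult_ac)
    \<comment> \<open>The pairs are split into the fibres of \<open>add\<close>; by
      \<open>add_in\<close> no pair is lost when \<gamma> ranges over \<open>A (m + n)\<close>
      only.\<close>
    also have "\<dots> = (\<Sum>\<gamma>\<in>A (m + n). \<Sum>z | z \<in> A m \<times> A n \<and> add z = \<gamma>.
        c (fst z) * d (snd z) * mono (add z) x)"
      by (rule sum.group[symmetric]) (use fin add_in in auto)
    also have "\<dots> = (\<Sum>\<gamma>\<in>A (m + n). e \<gamma> * mono \<gamma> x)"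
      by (auto simp: e_def sum_distrib_right intro!: sum.cong)
    finally show ?thesis .
  qed
  then show ?thesis
    unfolding polynomials_degree_le_def A_def mono_def by blast
qed

text \<open>Extension by zero respects products: off \<Omega> both factors vanish, and so does the
  product of the extensions.\<close>

lemma poly_space_mult:
  assumes "p \<in> poly_space m \<Omega>" and "q \<in> poly_space n \<Omega>"
  shows "(\<lambda>x. p x * q x) \<in> poly_space (m + n) \<Omega>"
proof -
  obtain p' q' where "p' \<in> polynomials_degree_le m" "p = (\<lambda>x. if x \<in> \<Omega> then p' x else 0)"
    "q' \<in> polynomials_degree_le n" "q = (\<lambda>x. if x \<in> \<Omega> then q' x else 0)"
    using assms unfolding poly_space_def by blast
  then show ?thesis
    unfolding poly_space_def
    by (intro image_eqI[of _ _ "\<lambda>x. p' x * q' x"] polynomials_degree_le_mult) auto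
qed

lemma discrete_inner_commute: "discrete_inner N x w f g = discrete_inner N x w g f"
  by (simp add: discrete_inner_def mult_ac)

lemma discrete_inner_diff_left:
  "discrete_inner N x w (f - g) h = discrete_inner N x w f h - discrete_inner N x w g h"
  by (simp add: discrete_inner_def algebra_simps sum_subtractf)

lemma discrete_inner_sum_right:
  "discrete_inner N x w f (\<lambda>y. \<Sum>l\<in>A. c l * g l y) = (\<Sum>l\<in>A. c l * discrete_inner N x w f (g l))"
  unfolding discrete_inner_def sum_distrib_left
  by (subst sum.swap) (simp add: mult_ac)

lemma discrete_inner_self_nonneg:
  assumes "\<And>j. j \<in> {1..N} \<Longrightarrow> w j \<ge> 0"
  shows "discrete_inner N x w f f \<ge> 0"
  unfolding discrete_inner_def by (intro sum_nonneg) (simp add: assms mult.assoc)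

lemma discrete_orthonormal:
  assumes basis: "orthonormal_basis M \<Omega> n \<Phi>"
    and quad: "exact_quadrature M \<Omega> (2 * n) N x w"
    and k: "k \<in> {1..poly_dim n \<Omega>}" and l: "l \<in> {1..poly_dim n \<Omega>}"
  shows "discrete_inner N x w (\<Phi> k) (\<Phi> l) = (if k = l then 1 else 0)"
proof -
  \<comment> \<open>A basis function lies in the span of the basis, which is the polynomial space
    itself.\<close>
  have "\<Phi> i \<in> poly_space n \<Omega>" if "i \<in> {1..poly_dim n \<Omega>}" for i
    using basis that real_fun.span_base[of "\<Phi> i" "\<Phi> ` {1..poly_dim n \<Omega>}"]
    unfolding orthonormal_basis_def by blast
  with k l have "(\<lambda>y. \<Phi> k y * \<Phi> l y) \<in> poly_space (2 * n) \<Omega>"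
    unfolding mult_2 by (intro poly_space_mult)
  with quad have "discrete_inner N x w (\<Phi> k) (\<Phi> l) = L2_inner M (\<Phi> k) (\<Phi> l)"
    by (simp add: exact_quadrature_def discrete_inner_def L2_inner_def mult.assoc)
  with basis k l show ?thesis
    by (simp add: orthonormal_basis_def)
qed

theorem lemma3p1:
  fixes \<Omega> :: "(real^'s) set" and M :: "(real^'s) measure"
    and \<Phi> :: "nat \<Rightarrow> real^'s \<Rightarrow> real"
    and x :: "nat \<Rightarrow> real^'s" and w :: "nat \<Rightarrow> real"
    and f :: "real^'s \<Rightarrow> real" and lam :: real and m n N :: nat
  assumes "compact \<Omega>" and "smooth_submanifold_with_boundary m \<Omega>"
    and "space M = \<Omega>" and "sets (restrict_space borel \<Omega>) \<subseteq> sets M" and "finite_measure M"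
    and "orthonormal_basis M \<Omega> n \<Phi>"
    and "exact_quadrature M \<Omega> (2 * n) N x w"
    and "continuous_on \<Omega> f" and "lam > 0"
  shows "let H = hard_hyperinterpolation \<Omega> n \<Phi> N x w lam f in
      discrete_inner N x w (f - H) H = 0 \<and>
      discrete_inner N x w H H + discrete_inner N x w (f - H) (f - H) = discrete_inner N x w f f \<and>
      discrete_inner N x w H H \<le> discrete_inner N x w f f"
proof -
  define H where "H = hard_hyperinterpolation \<Omega> n \<Phi> N x w lam f"
  define a where "a l = discrete_inner N x w f (\<Phi> l)" for l
  define h where "h l = hard_threshold (a l) lam" for l
  let ?D = "{1..poly_dim n \<Omega>}"
  have H: "H = (\<lambda>y. \<Sum>l\<in>?D. h l * \<Phi> l y)"
    by (simp add: H_def hard_hyperinterpolation_def h_def a_def)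
  have "discrete_inner N x w H (\<Phi> l) = h l" if "l \<in> ?D" for l
  proof -
    \<comment> \<open>Symmetry moves \<open>H\<close> to the right argument, where its expansion in
      the basis can be pulled out; discrete orthonormality then leaves only the term
      \<open>k = l\<close>.\<close>
    have "discrete_inner N x w H (\<Phi> l) = (\<Sum>k\<in>?D. h k * discrete_inner N x w (\<Phi> l) (\<Phi> k))"
      unfolding H by (subst discrete_inner_commute) (rule discrete_inner_sum_right)
    also have "\<dots> = (\<Sum>k\<in>?D. if l = k then h k else 0)"
      using discrete_orthonormal[OF assms(6,7) that] by (intro sum.cong) auto
    also have "\<dots> = h l"
      using that by (subst sum.delta') auto
    finally show ?thesis .
  qed
  then have "discrete_inner N x w H H = (\<Sum>l\<in>?D. h l * h l)"
    \<comment> \<open>Only one argument is expanded; the other stays \<open>H\<close>, so that the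
      coefficients just computed appear.\<close>
    by (subst (2) H) (simp add: discrete_inner_sum_right)
  also have "\<dots> = (\<Sum>l\<in>?D. h l * a l)"
    by (intro sum.cong) (auto simp: h_def hard_threshold_def)
  also have "\<dots> = discrete_inner N x w f H"
    by (simp add: H discrete_inner_sum_right a_def)
  finally have fH: "discrete_inner N x w f H = discrete_inner N x w H H" ..
  then have orth: "discrete_inner N x w (f - H) H = 0"
    by (simp add: discrete_inner_diff_left)
  \<comment> \<open>Orthogonality removes \<open>H\<close> from one argument; expanding the other
    leaves the mixed term of \<open>f\<close> and \<open>H\<close>, which \<open>fH\<close> turns
    into the square of \<open>H\<close>.\<close>
  have "discrete_inner N x w (f - H) (f - H) = discrete_inner N x w f (f - H)"
    using orth by (simp add: discrete_inner_diff_left discrete_inner_commute[of _ _ _ H "f - H"])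
  also have "\<dots> = discrete_inner N x w f f - discrete_inner N x w H H"
    using fH by (simp add: discrete_inner_commute[of _ _ _ f "f - H"] discrete_inner_diff_left
        discrete_inner_commute[of _ _ _ H f])
  finally have pyth: "discrete_inner N x w H H + discrete_inner N x w (f - H) (f - H)
      = discrete_inner N x w f f"
    by simp
  have "discrete_inner N x w (f - H) (f - H) \<ge> 0"
    using assms(7) by (intro discrete_inner_self_nonneg) (auto simp: exact_quadrature_def less_imp_le)
  with orth pyth show ?thesis
    by (simp add: Let_def flip: H_def)
qed

end
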